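(* Let $I$ be an $\mathsf{ad}$-nilpotent ideal. Then $I\in\mathfrak{Ad}(\mathfrak g)_0$ (i.e. $I\cap\Pi=\varnothing$) if and only if the region $R_I$ is bounded.
   Context: Let $\Delta$ be the (reduced, irreducible, crystallographic) root system of a simple Lie algebra $\mathfrak g$, with positive roots $\Delta^+$ and simple roots $\Pi$, spanning a real vector space $V$ with a Weyl group invariant inner product $(\ ,\ )$; let $\mathcal C=\{x\in V\mid(x,\alpha)>0\ \ \forall\alpha\in\Pi\}$ be the (open) fundamental Weyl chamber. An $\mathsf{ad}$-nilpotent ideal is a subset $I\subset\Delta^+$ such that $\gamma\in I$, $\nu\in\Delta^+$, $\gamma+\nu\in\Delta$ imply $\gamma+\nu\in I$. $\mathfrak{Ad}(\mathfrak g)_0$ is the set of $\mathsf{ad}$-nilpotent ideals containing no simple root. The Catalan arrangement $\mathrm{Cat}(\Delta)$ is the set of hyperplanes $(x,\mu)=1$, $(x,\mu)=0$, $(x,\mu)=-1$ ($\mu\in\Delta^+$) in $V$; its regions are the connected components of the complement of the union of its hyperplanes. By a theorem of Shi, the map $I\mapsto R_I=\{x\in\mathcal C\mid(x,\gamma)>1\text{ if }\gamma\in I,\ (x,\gamma)<1\text{ if }\gamma\in\Delta^+\setminus I\}$ is a bijection from $\mathsf{ad}$-nilpotent ideals to the regions of $\mathrm{Cat}(\Delta)$ contained in $\mathcal C$. A region is bounded if it is contained in a sphere (ball) about the origin. *)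

theory Defs
  imports "HOL-Analysis.Analysis"
begin

text \<open>
  Root systems live in a Euclidean space \<open>'a\<close> and span it, so \<open>'a\<close> plays the role of \<open>V\<close>.
  The inner product of \<open>'a\<close> is Weyl group invariant automatically, because the
  reflections are the orthogonal ones. The set of simple roots is written \<open>S\<close>, as \<open>\<Pi>\<close> is
  the binder of dependent products.
\<close>

definition root_reflection :: "'a::euclidean_space \<Rightarrow> 'a \<Rightarrow> 'a" where
  "root_reflection \<alpha> x = x - (2 * (x \<bullet> \<alpha>) / (\<alpha> \<bullet> \<alpha>)) *\<^sub>R \<alpha>"

definition crystallographic_root_system :: "'a::euclidean_space set \<Rightarrow> bool" where
  "crystallographic_root_system \<Delta> \<longleftrightarrow>
     finite \<Delta> \<and> 0 \<notin> \<Delta> \<and> span \<Delta> = UNIV \<and>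
     (\<forall>\<alpha>\<in>\<Delta>. root_reflection \<alpha> ` \<Delta> = \<Delta>) \<and>
     (\<forall>\<alpha>\<in>\<Delta>. \<forall>\<beta>\<in>\<Delta>. 2 * (\<beta> \<bullet> \<alpha>) / (\<alpha> \<bullet> \<alpha>) \<in> \<int>)"

definition reduced_roots :: "'a::euclidean_space set \<Rightarrow> bool" where
  "reduced_roots \<Delta> \<longleftrightarrow> (\<forall>\<alpha>\<in>\<Delta>. \<forall>c. c *\<^sub>R \<alpha> \<in> \<Delta> \<longrightarrow> c = 1 \<or> c = -1)"

definition irreducible_roots :: "'a::euclidean_space set \<Rightarrow> bool" where
  "irreducible_roots \<Delta> \<longleftrightarrow> \<Delta> \<noteq> {} \<and>
     \<not> (\<exists>A B. A \<noteq> {} \<and> B \<noteq> {} \<and> A \<union> B = \<Delta> \<and> A \<inter> B = {} \<and> (\<forall>\<alpha>\<in>A. \<forall>\<beta>\<in>B. \<alpha> \<bullet> \<beta> = 0))"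

definition simple_roots :: "'a::euclidean_space set \<Rightarrow> 'a set \<Rightarrow> bool" where
  "simple_roots \<Delta> S \<longleftrightarrow> S \<subseteq> \<Delta> \<and> independent S \<and> span S = UNIV \<and>
     (\<forall>\<beta>\<in>\<Delta>. \<exists>c :: 'a \<Rightarrow> int. \<beta> = (\<Sum>\<alpha>\<in>S. of_int (c \<alpha>) *\<^sub>R \<alpha>) \<and>
        ((\<forall>\<alpha>\<in>S. 0 \<le> c \<alpha>) \<or> (\<forall>\<alpha>\<in>S. c \<alpha> \<le> 0)))"

definition positive_roots :: "'a::euclidean_space set \<Rightarrow> 'a set \<Rightarrow> 'a set" where
  "positive_roots \<Delta> S =
     {\<beta>\<in>\<Delta>. \<exists>c :: 'a \<Rightarrow> int. \<beta> = (\<Sum>\<alpha>\<in>S. of_int (c \<alpha>) *\<^sub>R \<alpha>) \<and> (\<forall>\<alpha>\<in>S. 0 \<le> c \<alpha>)}"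

definition fundamental_chamber :: "'a::euclidean_space set \<Rightarrow> 'a set" where
  "fundamental_chamber S = {x. \<forall>\<alpha>\<in>S. x \<bullet> \<alpha> > 0}"

definition ad_nilpotent_ideals :: "'a::euclidean_space set \<Rightarrow> 'a set \<Rightarrow> 'a set set" where
  "ad_nilpotent_ideals \<Delta> S =
     {I. I \<subseteq> positive_roots \<Delta> S \<and>
         (\<forall>\<gamma>\<in>I. \<forall>\<nu>\<in>positive_roots \<Delta> S. \<gamma> + \<nu> \<in> \<Delta> \<longrightarrow> \<gamma> + \<nu> \<in> I)}"

definition ad_nilpotent_ideals0 :: "'a::euclidean_space set \<Rightarrow> 'a set \<Rightarrow> 'a set set" where
  "ad_nilpotent_ideals0 \<Delta> S = {I \<in> ad_nilpotent_ideals \<Delta> S. I \<inter> S = {}}"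

definition ideal_region :: "'a::euclidean_space set \<Rightarrow> 'a set \<Rightarrow> 'a set \<Rightarrow> 'a set" where
  "ideal_region \<Delta> S I =
     {x \<in> fundamental_chamber S.
        (\<forall>\<gamma>\<in>I. x \<bullet> \<gamma> > 1) \<and> (\<forall>\<gamma>\<in>positive_roots \<Delta> S - I. x \<bullet> \<gamma> < 1)}"

end

theory Submission
  imports Defs "HOL-Library.Multiset"
begin

text \<open>
  If \<open>I\<close> contains no simple root, then \<open>0 < (x, \<alpha>) < 1\<close> on \<open>R\<^sub>I\<close> for all simple \<open>\<alpha>\<close>, which bounds
  \<open>R\<^sub>I\<close>. Conversely, the key is that a sum of \<open>n \<ge> 1\<close> roots of \<open>I\<close> plus further positive roots is
  never a sum of at most \<open>n\<close> positive roots outside \<open>I\<close>: in a minimal such relation no summand on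
  the left has a positive inner product with a summand on the right, as otherwise their difference
  is zero or a root and yields a smaller relation; hence the common value of the two sides has norm
  zero. By separation of convex sets and clearing of denominators, the absence of such relations
  shows that \<open>R\<^sub>I\<close> is not empty. It also shows that a simple root \<open>\<alpha> \<in> I\<close> does not occur in the
  expansion of a positive root outside \<open>I\<close>, so that \<open>R\<^sub>I\<close> is stable under adding positive multiples
  of the fundamental coweight of \<open>\<alpha>\<close>.
\<close>

section \<open>Integer relations and multisets of vectors\<close>

text \<open>
  A simultaneous Dirichlet approximation of the real coefficients satisfies the same integral
  linear equations as soon as its error is small enough.
\<close>

lemma nonneg_integer_relation:
  fixes G J :: "'b::real_inner set" and u :: "'b \<Rightarrow> real"
  assumes G: "finite G" and J: "finite J"
    and int: "\<And>g j. g \<in> G \<Longrightarrow> j \<in> J \<Longrightarrow> g \<bullet> j \<in> \<int>"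
    and u: "\<And>g. g \<in> G \<Longrightarrow> 0 \<le> u g" and g0: "g0 \<in> G" "0 < u g0"
    and rel: "(\<Sum>g\<in>G. u g *\<^sub>R g) = 0"
  obtains p :: "'b \<Rightarrow> nat"
  where "0 < p g0" "\<And>j. j \<in> J \<Longrightarrow> (\<Sum>g\<in>G. of_nat (p g) *\<^sub>R g) \<bullet> j = 0"
proof -
  \<comment> \<open>\<open>M\<close> dominates the sum of |g \<bullet> j| over \<open>G\<close> for
    each single j in \<open>J\<close>. An approximation error below 1 / (M + 1) therefore moves each
    pairing by less than 1, which is enough since an integer of absolute value below 1 is zero.
    Keeping the error also below \<open>u g0\<close> makes the approximant at \<open>g0\<close>
    positive.\<close>
  define M where "M = (\<Sum>g\<in>G. \<Sum>j\<in>J. \<bar>g \<bullet> j\<bar>)"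
  have M0: "0 \<le> M" unfolding M_def by (intro sum_nonneg) auto
  have "0 < min (u g0) (1 / (M + 1))" using g0 M0 by simp
  then obtain N0 where N0: "inverse (real (Suc N0)) < min (u g0) (1 / (M + 1))"
    using reals_Archimedean by blast
  define N where "N = Suc N0"
  have N: "0 < N" "1 / real N < u g0" "1 / real N < 1 / (M + 1)"
    using N0 by (auto simp: N_def inverse_eq_divide)
  obtain h where h: "bij_betw h {0..<card G} G" using ex_bij_betw_nat_finite[OF G] by blast
  obtain q p where q: "0 < q"
    and p: "\<And>i. i < card G \<Longrightarrow> \<bar>of_int q * u (h i) - of_int (p i)\<bar> < 1 / N"
    using Dirichlet_approx_simult[OF N(1), of "card G" "\<lambda>i. u (h i)"] by metis
  define P where "P g = p (inv_into {0..<card G} h g)" for g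
  have P: "\<bar>of_int q * u g - of_int (P g)\<bar> < 1 / N" if "g \<in> G" for g
  proof -
    have "inv_into {0..<card G} h g \<in> {0..<card G}" "h (inv_into {0..<card G} h g) = g"
      using h that by (metis bij_betw_def inv_into_into, metis bij_betw_def f_inv_into_f)
    then show ?thesis using p[of "inv_into {0..<card G} h g"] by (auto simp: P_def)
  qed
  have N1: "1 / real N \<le> 1" using N(1) by simp
  have q1: "1 \<le> real_of_int q" using q by simp
  have Pnn: "0 \<le> P g" if "g \<in> G" for g
  proof -
    have "0 \<le> of_int q * u g" using u[OF that] q by simp
    then have "- 1 < real_of_int (P g)" using P[OF that] N1 by linarith
    then show ?thesis by linarith
  qed
  have "u g0 \<le> of_int q * u g0" using q1 g0(2) by simp
  then have "0 < real_of_int (P g0)" using P[OF g0(1)] N(2) by linarith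
  then have Ppos: "0 < P g0" by simp
  have eq0: "(\<Sum>g\<in>G. of_int (P g) *\<^sub>R g) \<bullet> j = 0" if j: "j \<in> J" for j
  proof -
    have "(\<Sum>g\<in>G. u g * (g \<bullet> j)) = (\<Sum>g\<in>G. u g *\<^sub>R g) \<bullet> j" by (simp add: inner_sum_left)
    then have u0: "(\<Sum>g\<in>G. u g * (g \<bullet> j)) = 0" using rel by simp
    have e: "(\<Sum>g\<in>G. of_int (P g) *\<^sub>R g) \<bullet> j = (\<Sum>g\<in>G. of_int (P g) * (g \<bullet> j))"
      by (simp add: inner_sum_left)
    \<comment> \<open>Subtracting \<open>q\<close> times the real relation leaves only the
      approximation errors as coefficients.\<close>
    also have "\<dots> = (\<Sum>g\<in>G. of_int (P g) * (g \<bullet> j)) - of_int q * (\<Sum>g\<in>G. u g * (g \<bullet> j))"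
      using u0 by simp
    also have "\<dots> = (\<Sum>g\<in>G. (of_int (P g) - of_int q * u g) * (g \<bullet> j))"
      by (simp add: sum_distrib_left sum_subtractf left_diff_distrib mult.assoc)
    finally have "\<bar>(\<Sum>g\<in>G. of_int (P g) *\<^sub>R g) \<bullet> j\<bar>
        \<le> (\<Sum>g\<in>G. \<bar>(of_int (P g) - of_int q * u g) * (g \<bullet> j)\<bar>)"
      by simp
    also have "\<dots> \<le> (\<Sum>g\<in>G. 1 / N * \<bar>g \<bullet> j\<bar>)"
    proof (rule sum_mono)
      fix g assume "g \<in> G"
      then have "\<bar>of_int (P g) - of_int q * u g\<bar> \<le> 1 / N" using P[of g] by linarith
      then show "\<bar>(of_int (P g) - of_int q * u g) * (g \<bullet> j)\<bar> \<le> 1 / N * \<bar>g \<bullet> j\<bar>"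
        unfolding abs_mult by (rule mult_right_mono) simp
    qed
    also have "\<dots> = 1 / N * (\<Sum>g\<in>G. \<bar>g \<bullet> j\<bar>)" by (simp add: sum_distrib_left)
    also have "\<dots> \<le> 1 / N * M" unfolding M_def
      by (intro mult_left_mono sum_mono) (auto intro: member_le_sum[OF j] simp: J)
    also have "\<dots> \<le> 1 / (M + 1) * M" using N(3) M0 by (intro mult_right_mono) auto
    also have "\<dots> < 1" using M0 by (simp add: divide_simps)
    finally have lt: "\<bar>(\<Sum>g\<in>G. of_int (P g) *\<^sub>R g) \<bullet> j\<bar> < 1" .
    have "(\<Sum>g\<in>G. of_int (P g) *\<^sub>R g) \<bullet> j \<in> \<int>"
      unfolding e using int[OF _ j] by (intro Ints_sum Ints_mult) auto
    then show ?thesis using lt by (auto elim!: Ints_cases)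
  qed
  show thesis
  proof
    show "0 < nat (P g0)" using Ppos by simp
    fix j assume "j \<in> J"
    have "(\<Sum>g\<in>G. real (nat (P g)) *\<^sub>R g) = (\<Sum>g\<in>G. of_int (P g) *\<^sub>R g)"
      by (rule sum.cong) (auto simp: Pnn)
    then show "(\<Sum>g\<in>G. real (nat (P g)) *\<^sub>R g) \<bullet> j = 0" using eq0[OF \<open>j \<in> J\<close>] by simp
  qed
qed

section \<open>Multisets of vectors and their sums\<close>

definition weighted_mset :: "('a \<Rightarrow> nat) \<Rightarrow> 'a set \<Rightarrow> 'a multiset" where
  "weighted_mset f X = (\<Sum>x\<in>X. replicate_mset (f x) x)"

lemma size_weighted_mset: "size (weighted_mset f X) = (\<Sum>x\<in>X. f x)"
  by (induction X rule: infinite_finite_induct) (auto simp: weighted_mset_def)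

lemma sum_mset_replicate_scaleR:
  fixes x :: "'a::real_vector"
  shows "sum_mset (replicate_mset n x) = of_nat n *\<^sub>R x"
  by (induction n) (auto simp: scaleR_add_left)

lemma sum_weighted_mset:
  fixes X :: "'a::real_vector set"
  assumes "finite X"
  shows "sum_mset (weighted_mset f X) = (\<Sum>x\<in>X. of_nat (f x) *\<^sub>R x)"
  using assms by (induction X) (auto simp: weighted_mset_def sum_mset_replicate_scaleR)

lemma set_weighted_mset: "finite X \<Longrightarrow> set_mset (weighted_mset f X) = {x\<in>X. 0 < f x}"
  by (induction X rule: finite_induct) (auto simp: weighted_mset_def split: if_splits)

lemma inner_sum_mset_right:
  fixes x :: "'a::real_inner"
  shows "x \<bullet> sum_mset M = (\<Sum>y\<in>#M. x \<bullet> y)"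
  by (induction M) (auto simp: inner_add_right)

lemma inner_sum_mset_nonpos:
  fixes M N :: "'a::real_inner multiset"
  assumes "\<And>x y. x \<in># M \<Longrightarrow> y \<in># N \<Longrightarrow> x \<bullet> y \<le> 0"
  shows "sum_mset M \<bullet> sum_mset N \<le> 0"
proof -
  have "x \<bullet> sum_mset N \<le> 0" if "x \<in># M" for x
    using assms[OF that] by (induction N) (auto simp: inner_add_right add_nonpos_nonpos)
  then show ?thesis
    by (induction M) (auto simp: inner_add_left add_nonpos_nonpos)
qed

section \<open>Dual vectors and boundedness in Euclidean space\<close>

lemma independent_prescribed_inner:
  fixes S :: "'a::euclidean_space set" and f :: "'a \<Rightarrow> real"
  assumes "independent S"
  obtains x where "\<And>\<alpha>. \<alpha> \<in> S \<Longrightarrow> \<alpha> \<bullet> x = f \<alpha>"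
proof -
  obtain F where F: "linear F" "\<And>\<alpha>. \<alpha> \<in> S \<Longrightarrow> F \<alpha> = f \<alpha>"
    using linear_independent_extend[OF assms] by blast
  \<comment> \<open>The adjoint of a functional, applied to 1, is the vector that represents
    it.\<close>
  show thesis
    by (rule that[of "adjoint F 1"]) (simp add: adjoint_works[OF F(1)] F(2))
qed

lemma not_bounded_ray:
  fixes x w :: "'a::real_normed_vector"
  assumes "\<And>t. 0 \<le> t \<Longrightarrow> x + t *\<^sub>R w \<in> R" and "w \<noteq> 0"
  shows "\<not> bounded R"
proof
  assume "bounded R"
  then obtain B where B: "\<And>y. y \<in> R \<Longrightarrow> norm y \<le> B" by (auto simp: bounded_iff)
  \<comment> \<open>This makes the norm of t w equal to B + norm x + 1, so x + t w has norm at least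
    B + 1.\<close>
  define t where "t = (B + norm x + 1) / norm w"
  have "0 \<le> B" using B[OF assms(1)[of 0]] norm_ge_zero[of x] by (simp del: norm_ge_zero)
  then have "0 \<le> t" by (simp add: t_def)
  then have "norm (t *\<^sub>R w) = t * norm w" by simp
  also have "\<dots> = B + norm x + 1" using \<open>w \<noteq> 0\<close> by (simp add: t_def)
  finally have "norm (t *\<^sub>R w) = B + norm x + 1" .
  moreover have "norm (t *\<^sub>R w) \<le> norm (x + t *\<^sub>R w) + norm x"
    using norm_triangle_ineq4[of "x + t *\<^sub>R w" x] by simp
  ultimately show False using B[OF assms(1)[OF \<open>0 \<le> t\<close>]] by simp
qed

text \<open>The vectors whose pairing with \<open>R\<close> is bounded form a subspace. Once it
  contains a spanning set it contains \<open>Basis\<close>, and the norm is at most the sum of the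
  absolute values of the coordinates.\<close>

lemma bounded_if_spanning_inner_bounded:
  fixes S R :: "'a::euclidean_space set"
  assumes "span S = UNIV" and "\<And>\<alpha>. \<alpha> \<in> S \<Longrightarrow> bounded ((\<lambda>x. x \<bullet> \<alpha>) ` R)"
  shows "bounded R"
proof -
  have "bounded ((\<lambda>x. x \<bullet> b) ` R)" for b
  proof -
    have "b \<in> span S" using assms(1) by simp
    then show ?thesis
    proof (induction rule: span_induct_alt)
      case base
      have "(\<lambda>x. x \<bullet> 0) ` R \<subseteq> {0::real}" by auto
      then show ?case by (rule bounded_subset[rotated]) simp
    next
      case (step c \<alpha> y)
      then have "bounded ((\<lambda>x. c *\<^sub>R (x \<bullet> \<alpha>)) ` R)"
        using bounded_scaling[OF assms(2)[of \<alpha>], of c] by (simp add: image_image)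
      then show ?case
        using bounded_plus_comp[of "\<lambda>x. c *\<^sub>R (x \<bullet> \<alpha>)" R "\<lambda>x. x \<bullet> y"] step
        by (simp add: inner_add_right)
    qed
  qed
  then have "\<exists>B. \<forall>x\<in>R. \<bar>x \<bullet> b\<bar> \<le> B" for b by (auto simp: bounded_iff)
  then obtain B where B: "\<And>b x. x \<in> R \<Longrightarrow> \<bar>x \<bullet> b\<bar> \<le> B b" by metis
  have "norm x \<le> (\<Sum>b\<in>Basis. B b)" if "x \<in> R" for x
    using norm_le_l1[of x] sum_mono[of Basis "\<lambda>b. \<bar>x \<bullet> b\<bar>" B] B[OF that] by force
  then show ?thesis by (auto simp: bounded_iff)
qed

section \<open>Positive roots and ideals\<close>

locale based_root_system =
  fixes \<Delta> S :: "'a::euclidean_space set"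
  assumes crystallographic: "crystallographic_root_system \<Delta>"
    and simple: "simple_roots \<Delta> S"
begin

abbreviation P :: "'a set" where "P \<equiv> positive_roots \<Delta> S"

lemma finite_roots: "finite \<Delta>" and zero_not_root: "0 \<notin> \<Delta>"
  using crystallographic by (auto simp: crystallographic_root_system_def)

lemma simple_subset: "S \<subseteq> \<Delta>" and independent_simple: "independent S"
  and span_simple: "span S = UNIV"
  using simple by (auto simp: simple_roots_def)

lemma finite_simple: "finite S"
  using simple_subset finite_roots finite_subset by blast

lemma positive_subset: "P \<subseteq> \<Delta>"
  by (auto simp: positive_roots_def)

lemma finite_positive: "finite P"
  using positive_subset finite_roots finite_subset by blast

lemma reflection_root: "\<alpha> \<in> \<Delta> \<Longrightarrow> \<beta> \<in> \<Delta> \<Longrightarrow> root_reflection \<alpha> \<beta> \<in> \<Delta>"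
  using crystallographic by (auto simp: crystallographic_root_system_def)

lemma uminus_root: "\<alpha> \<in> \<Delta> \<Longrightarrow> - \<alpha> \<in> \<Delta>"
  using reflection_root[of \<alpha> \<alpha>] zero_not_root
  by (auto simp: root_reflection_def scaleR_2 split: if_splits)

lemma positive_or_negative:
  assumes "\<beta> \<in> \<Delta>"
  shows "\<beta> \<in> P \<or> - \<beta> \<in> P"
proof -
  obtain c :: "'a \<Rightarrow> int" where c: "\<beta> = (\<Sum>\<alpha>\<in>S. of_int (c \<alpha>) *\<^sub>R \<alpha>)"
    "(\<forall>\<alpha>\<in>S. 0 \<le> c \<alpha>) \<or> (\<forall>\<alpha>\<in>S. c \<alpha> \<le> 0)"
    using simple assms unfolding simple_roots_def by meson
  from c(2) show ?thesis
  proof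
    assume "\<forall>\<alpha>\<in>S. 0 \<le> c \<alpha>"
    then show ?thesis using c(1) assms unfolding positive_roots_def by blast
  next
    assume "\<forall>\<alpha>\<in>S. c \<alpha> \<le> 0"
    moreover have "- \<beta> = (\<Sum>\<alpha>\<in>S. of_int (- c \<alpha>) *\<^sub>R \<alpha>)" by (simp add: c(1) sum_negf)
    ultimately show ?thesis using uminus_root[OF assms]
      unfolding positive_roots_def by (intro disjI2 CollectI conjI exI[of _ "\<lambda>\<alpha>. - c \<alpha>"]) auto
  qed
qed

lemma simple_positive: "S \<subseteq> P"
proof
  fix \<alpha> assume \<alpha>: "\<alpha> \<in> S"
  have "(\<Sum>\<beta>\<in>S. of_int (if \<beta> = \<alpha> then 1 else 0) *\<^sub>R \<beta>) = (\<Sum>\<beta>\<in>S. if \<beta> = \<alpha> then \<beta> else 0)"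
    by (rule sum.cong) auto
  also have "\<dots> = \<alpha>" using \<alpha> finite_simple by simp
  finally have "\<alpha> = (\<Sum>\<beta>\<in>S. of_int (if \<beta> = \<alpha> then 1 else 0) *\<^sub>R \<beta>)" ..
  then show "\<alpha> \<in> P" using \<alpha> simple_subset unfolding positive_roots_def
    by (intro CollectI conjI exI[of _ "\<lambda>\<beta>. if \<beta> = \<alpha> then 1 else 0"]) auto
qed

section \<open>Fundamental coweights and coefficients of roots\<close>

lemma coweight_exists: "\<exists>w. \<forall>\<beta>\<in>S. \<beta> \<bullet> w = (if \<beta> = \<alpha> then 1 else 0)"
  by (metis independent_prescribed_inner[OF independent_simple, of "\<lambda>\<beta>. if \<beta> = \<alpha> then 1 else 0"])

text \<open>These vectors form the basis dual to \<open>S\<close>: pairing with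
  \<open>coweight \<alpha>\<close> reads off the coefficient of the simple root \<alpha>. As
  \<open>S\<close> spans, the choice is unique.\<close>

definition coweight :: "'a \<Rightarrow> 'a" where
  "coweight \<alpha> = (SOME w. \<forall>\<beta>\<in>S. \<beta> \<bullet> w = (if \<beta> = \<alpha> then 1 else 0))"

lemma inner_coweight: "\<beta> \<in> S \<Longrightarrow> \<beta> \<bullet> coweight \<alpha> = (if \<beta> = \<alpha> then 1 else 0)"
  using someI_ex[OF coweight_exists[of \<alpha>]] unfolding coweight_def by blast

lemma inner_coweight_sum:
  assumes "\<alpha> \<in> S"
  shows "(\<Sum>\<beta>\<in>S. c \<beta> *\<^sub>R \<beta>) \<bullet> coweight \<alpha> = c \<alpha>"
proof -
  have "(\<Sum>\<beta>\<in>S. c \<beta> *\<^sub>R \<beta>) \<bullet> coweight \<alpha> = (\<Sum>\<beta>\<in>S. if \<beta> = \<alpha> then c \<beta> else 0)"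
    unfolding inner_sum_left by (rule sum.cong) (auto simp: inner_coweight)
  then show ?thesis using assms finite_simple by simp
qed

lemma eq_zero_if_coweights_vanish:
  assumes "\<And>\<alpha>. \<alpha> \<in> S \<Longrightarrow> v \<bullet> coweight \<alpha> = 0"
  shows "v = 0"
proof -
  have "v \<in> span S" using span_simple by simp
  then obtain c where c: "v = (\<Sum>\<beta>\<in>S. c \<beta> *\<^sub>R \<beta>)"
    unfolding span_finite[OF finite_simple] by blast
  then have "c \<alpha> = 0" if "\<alpha> \<in> S" for \<alpha>
    using assms[OF that] inner_coweight_sum[OF that, of c] by simp
  then show ?thesis using c by simp
qed

text \<open>With natural numbers as coefficients, the expansion can be turned into a multiset of
  simple roots.\<close>

lemma positive_expansion:
  assumes "\<beta> \<in> P"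
  obtains c :: "'a \<Rightarrow> nat"
  where "\<beta> = (\<Sum>\<alpha>\<in>S. of_nat (c \<alpha>) *\<^sub>R \<alpha>)"
proof -
  obtain c :: "'a \<Rightarrow> int" where c: "\<beta> = (\<Sum>\<alpha>\<in>S. of_int (c \<alpha>) *\<^sub>R \<alpha>)" "\<forall>\<alpha>\<in>S. 0 \<le> c \<alpha>"
    using assms by (auto simp: positive_roots_def)
  show thesis
    by (rule that[of "\<lambda>\<alpha>. nat (c \<alpha>)"]) (use c in \<open>auto intro!: sum.cong\<close>)
qed

lemma positive_inner_coweight:
  assumes "\<beta> \<in> P" "\<alpha> \<in> S"
  shows "\<beta> \<bullet> coweight \<alpha> \<in> \<nat>"
  by (metis assms inner_coweight_sum of_nat_in_Nats positive_expansion)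

text \<open>Pairing with the sum \<rho> of the coweights gives the height, which is positive on
  every positive root and additive over the multiset.\<close>

lemma sum_positive_eq_0:
  assumes "set_mset M \<subseteq> P" "sum_mset M = 0"
  shows "M = {#}"
proof -
  define \<rho> where "\<rho> = (\<Sum>\<alpha>\<in>S. coweight \<alpha>)"
  have \<rho>: "0 < \<rho> \<bullet> \<beta>" if "\<beta> \<in> P" for \<beta>
  proof -
    have nn: "0 \<le> \<beta> \<bullet> coweight \<alpha>" if "\<alpha> \<in> S" for \<alpha>
      using positive_inner_coweight[OF \<open>\<beta> \<in> P\<close> that] by (auto elim: Nats_cases)
    have "\<beta> \<noteq> 0" using that positive_subset zero_not_root by blast
    then obtain \<alpha> where "\<alpha> \<in> S" "\<beta> \<bullet> coweight \<alpha> \<noteq> 0"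
      using eq_zero_if_coweights_vanish by blast
    then have "0 < (\<Sum>\<alpha>\<in>S. \<beta> \<bullet> coweight \<alpha>)"
      using nn finite_simple by (intro sum_pos2[of S \<alpha>]) (auto simp: order.strict_iff_order)
    then show ?thesis by (simp add: \<rho>_def inner_sum_right inner_commute)
  qed
  have "0 < (\<Sum>\<beta>\<in>#M. \<rho> \<bullet> \<beta>)" if "M \<noteq> {#}"
    using that assms(1)
  proof (induction M)
    case (add x M)
    then show ?case using \<rho>[of x] by (cases "M = {#}") auto
  qed simp
  then show ?thesis using assms(2) inner_sum_mset_right[of \<rho> M] by force
qed

section \<open>Differences of roots and relations between positive roots\<close>

lemma diff_root:
  assumes \<alpha>: "\<alpha> \<in> \<Delta>" and \<beta>: "\<beta> \<in> \<Delta>" and pos: "0 < \<alpha> \<bullet> \<beta>" and "\<alpha> \<noteq> \<beta>"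
  shows "\<alpha> - \<beta> \<in> \<Delta>"
proof -
  define m where "m = 2 * (\<alpha> \<bullet> \<beta>) / (\<beta> \<bullet> \<beta>)"
  define n where "n = 2 * (\<beta> \<bullet> \<alpha>) / (\<alpha> \<bullet> \<alpha>)"
  have nz: "0 < \<alpha> \<bullet> \<alpha>" "0 < \<beta> \<bullet> \<beta>" using \<alpha> \<beta> zero_not_root by auto
  have "m \<in> \<int>" "n \<in> \<int>" using crystallographic \<alpha> \<beta>
    by (auto simp: crystallographic_root_system_def m_def n_def)
  then obtain m' n' where mn: "m = of_int m'" "n = of_int n'" by (auto elim!: Ints_cases)
  have "0 < m" "0 < n" using nz pos by (auto simp: m_def n_def inner_commute)
  then have mn0: "1 \<le> m'" "1 \<le> n'" by (auto simp: mn)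
  \<comment> \<open>Both Cartan integers are positive. If both were at least 2, the squared norm of
    \<alpha> - \<beta> would be at most 0. So one of them is 1, and the corresponding reflection
    sends one root to its difference with the other.\<close>
  have "\<not> (2 \<le> m' \<and> 2 \<le> n')"
  proof
    assume "2 \<le> m' \<and> 2 \<le> n'"
    then have "2 \<le> m" "2 \<le> n" by (auto simp: mn)
    then have le: "\<beta> \<bullet> \<beta> \<le> \<alpha> \<bullet> \<beta>" "\<alpha> \<bullet> \<alpha> \<le> \<alpha> \<bullet> \<beta>"
      using nz by (auto simp: m_def n_def divide_simps inner_commute)
    have "(\<alpha> - \<beta>) \<bullet> (\<alpha> - \<beta>) = \<alpha> \<bullet> \<alpha> - 2 * (\<alpha> \<bullet> \<beta>) + \<beta> \<bullet> \<beta>"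
      by (simp add: inner_diff_left inner_diff_right inner_commute)
    then have "(\<alpha> - \<beta>) \<bullet> (\<alpha> - \<beta>) \<le> 0" using le by linarith
    then show False using \<open>\<alpha> \<noteq> \<beta>\<close> by (metis inner_ge_zero inner_eq_zero_iff order_antisym right_minus_eq)
  qed
  then consider "m' = 1" | "n' = 1" using mn0 by linarith
  then show ?thesis
  proof cases
    case 1
    then have "2 * (\<alpha> \<bullet> \<beta>) / (\<beta> \<bullet> \<beta>) = 1" using mn by (simp only: m_def of_int_1)
    then show ?thesis using reflection_root[OF \<beta> \<alpha>] unfolding root_reflection_def
      by (metis scaleR_one)
  next
    case 2
    then have "2 * (\<beta> \<bullet> \<alpha>) / (\<alpha> \<bullet> \<alpha>) = 1" using mn by (simp only: n_def of_int_1)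
    then have "\<beta> - \<alpha> \<in> \<Delta>" using reflection_root[OF \<alpha> \<beta>] unfolding root_reflection_def
      by (metis scaleR_one)
    then show ?thesis using uminus_root[of "\<beta> - \<alpha>"] by simp
  qed
qed

text \<open>The induction is lexicographic in the size of \<open>A\<close> and then in the joint
  size of \<open>B\<close> and \<open>C\<close>. The multiset \<open>C\<close> absorbs the positive
  differences produced by cancellation. Cancelling between \<open>A\<close> and \<open>B\<close>
  lowers both sizes by one; cancelling between \<open>C\<close> and \<open>B\<close> fixes
  \<open>A\<close> and never enlarges \<open>B\<close>. Both preserve the size inequality.\<close>

lemma no_exchange_relation:
  assumes I: "I \<in> ad_nilpotent_ideals \<Delta> S"
    and "set_mset A \<subseteq> I" "set_mset B \<subseteq> P - I" "set_mset C \<subseteq> P"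
    and "sum_mset A + sum_mset C = sum_mset B" "size B \<le> size A"
  shows "A = {#} \<and> B = {#} \<and> C = {#}"
  using assms(2-)
proof (induction "(A, B, C)" arbitrary: A B C
    rule: wf_induct_rule[OF wf_measures[of "[\<lambda>(A, B, C). size A, \<lambda>(A, B, C). size B + size C]"]])
  case (1 A B C)
  note IH = "1.hyps" and A = "1.prems"(1) and B = "1.prems"(2) and C = "1.prems"(3)
    and eq = "1.prems"(4) and le = "1.prems"(5)
  have IP: "I \<subseteq> P" using I by (simp add: ad_nilpotent_ideals_def)
  have ideal: "\<gamma> + \<nu> \<in> I" if "\<gamma> \<in> I" "\<nu> \<in> P" "\<gamma> + \<nu> \<in> P" for \<gamma> \<nu>
    using I that positive_subset by (auto simp: ad_nilpotent_ideals_def)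
  \<comment> \<open>If no pair has a positive inner product, the inner product of the two equal
    sides is at most 0, so the sum of \<open>B\<close> vanishes and \<open>B\<close> is
    empty.\<close>
  consider (empty) "B = {#}"
    | (A) \<gamma> \<beta> where "\<gamma> \<in># A" "\<beta> \<in># B" "0 < \<gamma> \<bullet> \<beta>"
    | (C) \<delta> \<beta> where "\<delta> \<in># C" "\<beta> \<in># B" "0 < \<beta> \<bullet> \<delta>"
  proof -
    have "B = {#}" if *: "\<And>\<gamma> \<beta>. \<gamma> \<in># A + C \<Longrightarrow> \<beta> \<in># B \<Longrightarrow> \<gamma> \<bullet> \<beta> \<le> 0"
    proof -
      have "sum_mset (A + C) \<bullet> sum_mset B \<le> 0" using * by (rule inner_sum_mset_nonpos)
      then have "sum_mset B \<bullet> sum_mset B \<le> 0" using eq by simp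
      then have "sum_mset B = 0" by (metis inner_eq_zero_iff inner_ge_zero order_antisym)
      then show ?thesis using sum_positive_eq_0 B by blast
    qed
    then show thesis using that by (metis inner_commute not_le union_iff)
  qed
  then show ?case
  proof cases
    case empty
    then have "A + C = {#}" using eq A C IP by (intro sum_positive_eq_0) auto
    then show ?thesis using empty by simp
  next
    case (A \<gamma> \<beta>)
    have \<gamma>I: "\<gamma> \<in> I" and \<gamma>: "\<gamma> \<in> P" and \<beta>: "\<beta> \<in> P" "\<beta> \<notin> I"
      using A \<open>set_mset A \<subseteq> I\<close> B IP by auto
    have "\<gamma> - \<beta> \<in> \<Delta>" using diff_root A(3) \<gamma>I \<gamma> \<beta> positive_subset by blast
    \<comment> \<open>Otherwise \<beta> = \<gamma> + (\<beta> - \<gamma>) would lie in the ideal.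
      The sign of the difference is thus forced, and \<gamma> - \<beta> may join
      \<open>C\<close>.\<close>
    moreover have "\<beta> - \<gamma> \<notin> P" using ideal[OF \<gamma>I, of "\<beta> - \<gamma>"] \<beta> by auto
    ultimately have \<mu>: "\<gamma> - \<beta> \<in> P" using positive_or_negative[of "\<gamma> - \<beta>"] by auto
    obtain A' B' where AB: "A = add_mset \<gamma> A'" "B = add_mset \<beta> B'"
      using A by (metis insert_DiffM)
    \<comment> \<open>The last conjunct is absurd, which closes this case.\<close>
    have "A' = {#} \<and> B' = {#} \<and> add_mset (\<gamma> - \<beta>) C = {#}"
      using \<open>set_mset A \<subseteq> I\<close> B C eq le \<mu>
      by (intro IH) (auto simp: AB algebra_simps)
    then show ?thesis by simp
  next
    case (C \<delta> \<beta>)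
    have \<delta>: "\<delta> \<in> P" and \<beta>: "\<beta> \<in> P" "\<beta> \<notin> I" using C \<open>set_mset C \<subseteq> P\<close> B by auto
    obtain B' C' where BC: "B = add_mset \<beta> B'" "C = add_mset \<delta> C'"
      using C by (metis insert_DiffM)
    have "A = {#}"
    proof (cases "\<beta> = \<delta>")
      case True
      have "A = {#} \<and> B' = {#} \<and> C' = {#}"
        using A B \<open>set_mset C \<subseteq> P\<close> eq le True by (intro IH) (auto simp: BC algebra_simps)
      then show ?thesis by simp
    next
      case False
      then have "\<beta> - \<delta> \<in> \<Delta>" using diff_root C(3) \<delta> \<beta> positive_subset by blast
      then consider "\<beta> - \<delta> \<in> P" | "\<delta> - \<beta> \<in> P" using positive_or_negative by fastforce
      then show ?thesis
      proof cases
        case 1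
        \<comment> \<open>Adding \<delta> to an element \<beta> - \<delta> of the ideal would put
          \<beta> into it; so \<beta> - \<delta> may replace \<beta> in \<open>B\<close>.\<close>
        then have "\<beta> - \<delta> \<notin> I" using ideal[of "\<beta> - \<delta>" \<delta>] \<delta> \<beta> by auto
        then have "A = {#} \<and> add_mset (\<beta> - \<delta>) B' = {#} \<and> C' = {#}"
          using A B \<open>set_mset C \<subseteq> P\<close> eq le 1 by (intro IH) (auto simp: BC algebra_simps)
        then show ?thesis by simp
      next
        case 2
        then have "A = {#} \<and> B' = {#} \<and> add_mset (\<delta> - \<beta>) C' = {#}"
          using A B \<open>set_mset C \<subseteq> P\<close> eq le by (intro IH) (auto simp: BC algebra_simps)
        then show ?thesis by simp
      qed
    qed
    \<comment> \<open>An empty \<open>A\<close> forces \<open>B\<close> to be empty by size, but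
      \<beta> belongs to \<open>B\<close>.\<close>
    then show ?thesis using le C(2) by auto
  qed
qed

lemma coweight_vanishes_outside_ideal:
  assumes I: "I \<in> ad_nilpotent_ideals \<Delta> S" and \<alpha>: "\<alpha> \<in> I" "\<alpha> \<in> S" and \<beta>: "\<beta> \<in> P - I"
  shows "\<beta> \<bullet> coweight \<alpha> = 0"
proof (rule ccontr)
  assume nz: "\<beta> \<bullet> coweight \<alpha> \<noteq> 0"
  obtain c :: "'a \<Rightarrow> nat" where c: "\<beta> = (\<Sum>\<gamma>\<in>S. of_nat (c \<gamma>) *\<^sub>R \<gamma>)"
    using \<beta> positive_expansion by blast
  have "\<beta> \<bullet> coweight \<alpha> = of_nat (c \<alpha>)" using inner_coweight_sum[OF \<alpha>(2), of "\<lambda>\<gamma>. of_nat (c \<gamma>)"] c by simp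
  then have "0 < c \<alpha>" using nz by simp
  \<comment> \<open>One copy of \<alpha> is split off from the expansion of \<beta>. The remaining
    simple roots form \<open>C\<close>, giving a forbidden relation with a single ideal root against
    a single root outside the ideal.\<close>
  define C where "C = weighted_mset c S - {#\<alpha>#}"
  have W: "weighted_mset c S = add_mset \<alpha> C"
    using \<open>0 < c \<alpha>\<close> \<alpha>(2) by (simp add: C_def set_weighted_mset finite_simple)
  have "set_mset C \<subseteq> S"
    using in_diffD[of _ "weighted_mset c S"] by (auto simp: C_def set_weighted_mset finite_simple)
  moreover have "\<alpha> + sum_mset C = \<beta>"
    using sum_weighted_mset[OF finite_simple, of c] c W by simp
  ultimately show False
    using no_exchange_relation[OF I, of "{#\<alpha>#}" "{#\<beta>#}" C] \<alpha> \<beta> simple_positive by auto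
qed

text \<open>The inequalities for x are homogenized by writing x = y / s with s > 0. They then ask
  for a vector (y, s) with positive inner product with every element of a finite set
  \<open>G\<close>. Separation provides one unless 0 lies in the convex hull of \<open>G\<close>,
  and that would yield an exchange relation.\<close>

lemma ideal_region_nonempty:
  assumes I: "I \<in> ad_nilpotent_ideals \<Delta> S"
  shows "ideal_region \<Delta> S I \<noteq> {}"
proof -
  have IP: "I \<subseteq> P" using I by (simp add: ad_nilpotent_ideals_def)
  have fin: "finite I" "finite (P - I)" using IP finite_positive finite_subset by auto
  \<comment> \<open>\<open>G1\<close> encodes y \<bullet> \<gamma> > s on the ideal,
    \<open>G2\<close> encodes y \<bullet> \<beta> < s outside it, \<open>G3\<close> encodes the
    chamber, and (0, 1) encodes s > 0.\<close>
  define G1 :: "('a \<times> real) set" where "G1 = (\<lambda>\<gamma>. (\<gamma>, -1)) ` I"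
  define G2 :: "('a \<times> real) set" where "G2 = (\<lambda>\<beta>. (- \<beta>, 1)) ` (P - I)"
  define G3 :: "('a \<times> real) set" where "G3 = (\<lambda>\<alpha>. (\<alpha>, 0)) ` S"
  define G where "G = insert (0, 1) (G1 \<union> G2 \<union> G3)"
  have finG: "finite G1" "finite G2" "finite G3" "finite G"
    using fin finite_simple by (auto simp: G1_def G2_def G3_def G_def)
  have "0 \<notin> convex hull G"
  proof
    assume "0 \<in> convex hull G"
    then obtain u where u: "\<And>g. g \<in> G \<Longrightarrow> 0 \<le> u g" "sum u G = 1" "(\<Sum>g\<in>G. u g *\<^sub>R g) = 0"
      using convex_hull_finite[OF finG(4)] by auto
    obtain g0 where g0: "g0 \<in> G" "0 < u g0"
    proof -
      have "\<exists>g\<in>G. u g \<noteq> 0" using u(2) by (metis sum.neutral zero_neq_one)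
      then show thesis using u(1) that by (metis order_less_le)
    qed
    \<comment> \<open>These test vectors pair integrally with \<open>G\<close>, and a vector
      orthogonal to all of them is zero.\<close>
    define J :: "('a \<times> real) set" where "J = insert (0, 1) ((\<lambda>\<alpha>. (coweight \<alpha>, 0)) ` S)"
    have "finite J" using finite_simple by (simp add: J_def)
    moreover have "g \<bullet> j \<in> \<int>" if "g \<in> G" "j \<in> J" for g j
    proof -
      have "\<beta> \<bullet> coweight \<alpha> \<in> \<int>" if "\<beta> \<in> P" "\<alpha> \<in> S" for \<alpha> \<beta>
        using positive_inner_coweight[OF that] Nats_subset_Ints by blast
      then show ?thesis using that IP simple_positive
        by (auto simp: G_def G1_def G2_def G3_def J_def inner_prod_def)
    qed
    ultimately obtain p :: "'a \<times> real \<Rightarrow> nat" where p: "0 < p g0"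
      "\<And>j. j \<in> J \<Longrightarrow> (\<Sum>g\<in>G. of_nat (p g) *\<^sub>R g) \<bullet> j = 0"
      using nonneg_integer_relation[OF finG(4) _ _ u(1) g0 u(3)] by blast
    define v where "v = (\<Sum>g\<in>G. of_nat (p g) *\<^sub>R g)"
    have "fst v = 0"
    proof (rule eq_zero_if_coweights_vanish)
      fix \<alpha> assume "\<alpha> \<in> S"
      then show "fst v \<bullet> coweight \<alpha> = 0"
        using p(2)[of "(coweight \<alpha>, 0)"] by (simp add: v_def[symmetric] J_def inner_prod_def)
    qed
    moreover have "snd v = 0"
      using p(2)[of "(0, 1)"] by (simp add: v_def[symmetric] J_def inner_prod_def)
    moreover have "v = (0, of_nat (p (0, 1))) + (\<Sum>\<gamma>\<in>I. of_nat (p (\<gamma>, -1)) *\<^sub>R (\<gamma>, -1))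
        + (\<Sum>\<beta>\<in>P - I. of_nat (p (- \<beta>, 1)) *\<^sub>R (- \<beta>, 1)) + (\<Sum>\<alpha>\<in>S. of_nat (p (\<alpha>, 0)) *\<^sub>R (\<alpha>, 0))"
    proof -
      have disj: "(0, 1) \<notin> G1 \<union> G2 \<union> G3" "(G1 \<union> G2) \<inter> G3 = {}" "G1 \<inter> G2 = {}"
        using positive_subset zero_not_root by (auto simp: G1_def G2_def G3_def)
      have "v = of_nat (p (0, 1)) *\<^sub>R (0, 1) + ((\<Sum>g\<in>G1. of_nat (p g) *\<^sub>R g)
          + (\<Sum>g\<in>G2. of_nat (p g) *\<^sub>R g) + (\<Sum>g\<in>G3. of_nat (p g) *\<^sub>R g))"
        unfolding v_def G_def using finG disj by (simp add: sum.union_disjoint)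
      then show ?thesis
        unfolding G1_def G2_def G3_def by (simp add: sum.reindex inj_on_def add.assoc)
    qed
    moreover have fst_snd: "fst (\<Sum>x\<in>X. f x) = (\<Sum>x\<in>X. fst (f x))"
        "snd (\<Sum>x\<in>X. f x) = (\<Sum>x\<in>X. snd (f x))" for X and f :: "'a \<Rightarrow> 'a \<times> real"
      by (induction X rule: infinite_finite_induct) auto
    ultimately have rel: "(\<Sum>\<gamma>\<in>I. of_nat (p (\<gamma>, -1)) *\<^sub>R \<gamma>) + (\<Sum>\<alpha>\<in>S. of_nat (p (\<alpha>, 0)) *\<^sub>R \<alpha>)
          = (\<Sum>\<beta>\<in>P - I. of_nat (p (- \<beta>, 1)) *\<^sub>R \<beta>)"
      and cnt: "real (p (0, 1)) + (\<Sum>\<beta>\<in>P - I. real (p (- \<beta>, 1))) = (\<Sum>\<gamma>\<in>I. real (p (\<gamma>, -1)))"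
      by (simp_all add: fst_snd sum_negf algebra_simps)
    \<comment> \<open>The second coordinates count the roots on each side. The multiplicity of (0,
      1) is the slack in the inequality between the sizes of \<open>B\<close> and
      \<open>A\<close>.\<close>
    have cnt': "p (0, 1) + (\<Sum>\<beta>\<in>P - I. p (- \<beta>, 1)) = (\<Sum>\<gamma>\<in>I. p (\<gamma>, -1))"
      using cnt by (simp flip: of_nat_sum of_nat_add)
    define A where "A = weighted_mset (\<lambda>\<gamma>. p (\<gamma>, -1)) I"
    define B where "B = weighted_mset (\<lambda>\<beta>. p (- \<beta>, 1)) (P - I)"
    define C where "C = weighted_mset (\<lambda>\<alpha>. p (\<alpha>, 0)) S"
    have "A = {#} \<and> B = {#} \<and> C = {#}"
    proof (rule no_exchange_relation[OF I])
      show "set_mset A \<subseteq> I" "set_mset B \<subseteq> P - I" "set_mset C \<subseteq> P"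
        using fin finite_simple simple_positive by (auto simp: A_def B_def C_def set_weighted_mset)
      show "sum_mset A + sum_mset C = sum_mset B"
        unfolding A_def B_def C_def using rel fin finite_simple by (simp add: sum_weighted_mset)
      show "size B \<le> size A" unfolding A_def B_def size_weighted_mset using cnt' by linarith
    qed
    then have "set_mset A = {}" "set_mset B = {}" "set_mset C = {}" "size A = 0" by auto
    then have "\<forall>\<gamma>\<in>I. p (\<gamma>, -1) = 0" "\<forall>\<beta>\<in>P - I. p (- \<beta>, 1) = 0" "\<forall>\<alpha>\<in>S. p (\<alpha>, 0) = 0"
      "(\<Sum>\<gamma>\<in>I. p (\<gamma>, -1)) = 0"
      using fin finite_simple by (auto simp: A_def B_def C_def set_weighted_mset size_weighted_mset)
    \<comment> \<open>With the three multisets empty, the count also forces the multiplicity of (0,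
      1) to vanish.\<close>
    then have "p g = 0" if "g \<in> G" for g
      using that cnt' by (auto simp: G_def G1_def G2_def G3_def)
    then show False using p(1) g0(1) by simp
  qed
  moreover have "convex (convex hull G)" "closed (convex hull G)"
    using finite_imp_compact_convex_hull[OF finG(4)] by (auto intro: compact_imp_closed)
  ultimately obtain z b where z: "0 < b" "\<forall>g\<in>convex hull G. z \<bullet> g > b"
    using separating_hyperplane_closed_0[of "convex hull G"] by blast
  have z: "0 < fst z \<bullet> fst g + snd z * snd g" if "g \<in> G" for g
    using z hull_inc[OF that, of convex] by (fastforce simp: inner_prod_def)
  have s: "0 < snd z" using z[of "(0, 1)"] by (simp add: G_def)
  have "(1 / snd z) *\<^sub>R fst z \<in> ideal_region \<Delta> S I"
    unfolding ideal_region_def fundamental_chamber_def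
  proof (intro CollectI conjI ballI)
    fix \<alpha> assume "\<alpha> \<in> S"
    then show "0 < (1 / snd z) *\<^sub>R fst z \<bullet> \<alpha>" using s z[of "(\<alpha>, 0)"] by (simp add: G_def G3_def)
  next
    fix \<gamma> assume "\<gamma> \<in> I"
    then show "1 < (1 / snd z) *\<^sub>R fst z \<bullet> \<gamma>"
      using s z[of "(\<gamma>, -1)"] by (simp add: G_def G1_def)
  next
    fix \<beta> assume "\<beta> \<in> P - I"
    then have "(- \<beta>, 1) \<in> G" by (auto simp: G_def G2_def)
    then show "(1 / snd z) *\<^sub>R fst z \<bullet> \<beta> < 1"
      using s z[of "(- \<beta>, 1)"] by simp
  qed
  then show ?thesis by blast
qed

end

section \<open>The boundedness criterion\<close>

theorem proposition3p7:
  fixes \<Delta> S I :: "'a::euclidean_space set"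
  assumes "crystallographic_root_system \<Delta>"
    and "reduced_roots \<Delta>"
    and "irreducible_roots \<Delta>"
    and "simple_roots \<Delta> S"
    and "I \<in> ad_nilpotent_ideals \<Delta> S"
  shows "I \<in> ad_nilpotent_ideals0 \<Delta> S \<longleftrightarrow> bounded (ideal_region \<Delta> S I)"
proof -
  interpret based_root_system \<Delta> S using assms(1,4) by unfold_locales
  note I = assms(5)
  show ?thesis
  proof
    assume "I \<in> ad_nilpotent_ideals0 \<Delta> S"
    then have "I \<inter> S = {}" by (simp add: ad_nilpotent_ideals0_def)
    then have "(\<lambda>x. x \<bullet> \<alpha>) ` ideal_region \<Delta> S I \<subseteq> {0..1}" if "\<alpha> \<in> S" for \<alpha>
    proof -
      have "\<alpha> \<in> P - I" using that simple_positive \<open>I \<inter> S = {}\<close> by auto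
      then show ?thesis using that
        by (auto simp: ideal_region_def fundamental_chamber_def less_imp_le)
    qed
    then show "bounded (ideal_region \<Delta> S I)"
      by (intro bounded_if_spanning_inner_bounded[OF span_simple])
        (metis bounded_closed_interval bounded_subset)
  next
    assume bdd: "bounded (ideal_region \<Delta> S I)"
    have "\<alpha> \<notin> S" if \<alpha>: "\<alpha> \<in> I" for \<alpha>
    proof
      assume \<alpha>S: "\<alpha> \<in> S"
      \<comment> \<open>Moving along \<open>w\<close> leaves the pairings with positive roots
        outside \<open>I\<close> fixed and lowers none of the others, so the upper bounds and the
        lower bounds all persist.\<close>
      define w where "w = coweight \<alpha>"
      have "w \<noteq> 0" using inner_coweight[OF \<alpha>S, of \<alpha>] by (auto simp: w_def)
      obtain x where x: "x \<in> ideal_region \<Delta> S I" using ideal_region_nonempty[OF I] by blast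
      have nn: "0 \<le> w \<bullet> \<beta>" if "\<beta> \<in> P" for \<beta>
        using positive_inner_coweight[OF that \<alpha>S] by (auto simp: w_def inner_commute elim: Nats_cases)
      have van: "w \<bullet> \<beta> = 0" if "\<beta> \<in> P - I" for \<beta>
        using coweight_vanishes_outside_ideal[OF I \<alpha> \<alpha>S that] by (simp add: w_def inner_commute)
      have "x + t *\<^sub>R w \<in> ideal_region \<Delta> S I" if t: "0 \<le> t" for t
      proof -
        have ge: "x \<bullet> \<beta> \<le> (x + t *\<^sub>R w) \<bullet> \<beta>" if "\<beta> \<in> P" for \<beta>
          using nn[OF that] t by (simp add: inner_add_left)
        have "(x + t *\<^sub>R w) \<bullet> \<beta> = x \<bullet> \<beta>" if "\<beta> \<in> P - I" for \<beta>
          using van[OF that] by (simp add: inner_add_left)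
        moreover have "I \<subseteq> P" using I by (simp add: ad_nilpotent_ideals_def)
        ultimately show ?thesis
          using x ge simple_positive unfolding ideal_region_def fundamental_chamber_def
          by (fastforce intro: less_le_trans)
      qed
      then show False using not_bounded_ray \<open>w \<noteq> 0\<close> bdd by blast
    qed
    then show "I \<in> ad_nilpotent_ideals0 \<Delta> S" using I by (auto simp: ad_nilpotent_ideals0_def)
  qed
qed

end
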